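(* Let $G=(V,E)$ be a connected graph and $S\subseteq V$. Then $S$ is a simultaneous dominating set of $G$ if and only if every vertex $v\in V$ satisfies $v\in S$ or one of the following: (i) $v$ is not a cut vertex of $G$ and $N_G(v)\subseteq S$; or (ii) $v$ is a cut vertex of $G$, and, denoting by $B_1,\ldots,B_k$ the blocks of $G$ containing $v$, there is some $i\in\{1,\ldots,k\}$ with $N_{B_i}(v)\subseteq S$.
   Context: All graphs are finite, simple and undirected. For a subgraph $H$ containing $v$, $N_H(v)=\{u\in V(H): \{u,v\}\in E(H)\}$. A set $S\subseteq V$ is dominating in a graph if every vertex not in $S$ has a neighbour in $S$ in that graph. For a connected graph $G$, a subset $S\subseteq V(G)$ is a simultaneous dominating set (SD-set) of $G$ if $S$ is a dominating set in every spanning tree of $G$. A cut vertex is a vertex $v$ such that $G-v$ has more connected components than $G$; a graph without cut vertex is called $2$-connected; a block of $G$ is a maximal $2$-connected subgraph of $G$.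
   Formalization: The case of a one-vertex graph G with S empty is excluded, since there condition (i) holds vacuously but the empty set does not dominate G; also, 2-connected graphs (and hence blocks) are required to be connected. *)

theory Defs
  imports Main
begin

type_synonym 'a ugraph = "'a set \<times> 'a set set"

abbreviation verts :: "'a ugraph \<Rightarrow> 'a set" where
  "verts G \<equiv> fst G"

abbreviation edges :: "'a ugraph \<Rightarrow> 'a set set" where
  "edges G \<equiv> snd G"

definition simple_graph :: "'a ugraph \<Rightarrow> bool" where
  "simple_graph G \<longleftrightarrow> finite (verts G) \<and> (\<forall>e\<in>edges G. e \<subseteq> verts G \<and> card e = 2)"

definition neighbours :: "'a ugraph \<Rightarrow> 'a \<Rightarrow> 'a set" where
  "neighbours G v = {u \<in> verts G. {u, v} \<in> edges G}"

definition subgraph :: "'a ugraph \<Rightarrow> 'a ugraph \<Rightarrow> bool" where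
  "subgraph H G \<longleftrightarrow> simple_graph H \<and> verts H \<subseteq> verts G \<and> edges H \<subseteq> edges G"

definition reach :: "'a ugraph \<Rightarrow> ('a \<times> 'a) set" where
  "reach G = {(u, v). u \<in> verts G \<and> v \<in> verts G \<and> (u, v) \<in> {(x, y). {x, y} \<in> edges G}\<^sup>*}"

text \<open>The vertex sets of the connected components.\<close>
definition components :: "'a ugraph \<Rightarrow> 'a set set" where
  "components G = verts G // reach G"

definition connected_graph :: "'a ugraph \<Rightarrow> bool" where
  "connected_graph G \<longleftrightarrow> verts G \<noteq> {} \<and> (\<forall>u\<in>verts G. \<forall>v\<in>verts G. (u, v) \<in> reach G)"

definition delete_vertex :: "'a ugraph \<Rightarrow> 'a \<Rightarrow> 'a ugraph" where
  "delete_vertex G v = (verts G - {v}, {e \<in> edges G. v \<notin> e})"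

definition cut_vertex :: "'a ugraph \<Rightarrow> 'a \<Rightarrow> bool" where
  "cut_vertex G v \<longleftrightarrow>
     v \<in> verts G \<and> card (components (delete_vertex G v)) > card (components G)"

text \<open>
  As usual, 2-connected graphs are required to be connected; without this, a block could be
  a disjoint union of pieces. A single vertex and a single edge count as 2-connected.
\<close>
definition two_connected :: "'a ugraph \<Rightarrow> bool" where
  "two_connected G \<longleftrightarrow> connected_graph G \<and> \<not> (\<exists>v. cut_vertex G v)"

definition block :: "'a ugraph \<Rightarrow> 'a ugraph \<Rightarrow> bool" where
  "block B G \<longleftrightarrow> subgraph B G \<and> two_connected B \<and>
     (\<forall>B'. subgraph B' G \<and> two_connected B' \<and> subgraph B B' \<longrightarrow> B' = B)"

text \<open>A cycle is given by the list of its vertices; the last one is adjacent to the first.\<close>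
definition cycle :: "'a ugraph \<Rightarrow> 'a list \<Rightarrow> bool" where
  "cycle G c \<longleftrightarrow> length c \<ge> 3 \<and> distinct c \<and> set c \<subseteq> verts G \<and>
     successively (\<lambda>x y. {x, y} \<in> edges G) c \<and> {last c, hd c} \<in> edges G"

definition tree :: "'a ugraph \<Rightarrow> bool" where
  "tree G \<longleftrightarrow> simple_graph G \<and> connected_graph G \<and> \<not> (\<exists>c. cycle G c)"

definition spanning_tree :: "'a ugraph \<Rightarrow> 'a ugraph \<Rightarrow> bool" where
  "spanning_tree T G \<longleftrightarrow> subgraph T G \<and> verts T = verts G \<and> tree T"

definition dominating :: "'a ugraph \<Rightarrow> 'a set \<Rightarrow> bool" where
  "dominating G S \<longleftrightarrow> S \<subseteq> verts G \<and> (\<forall>v\<in>verts G - S. neighbours G v \<inter> S \<noteq> {})"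

definition SD_set :: "'a ugraph \<Rightarrow> 'a set \<Rightarrow> bool" where
  "SD_set G S \<longleftrightarrow> S \<subseteq> verts G \<and> (\<forall>T. spanning_tree T G \<longrightarrow> dominating T S)"

end

theory Submission
  imports Defs
begin

text \<open>
  For a vertex \<open>v\<close> outside \<open>S\<close>, both sides say that some component \<open>C\<close> of \<open>G - v\<close> satisfies
  \<open>N(v) \<inter> C \<subseteq> S\<close>. Every spanning tree joins \<open>v\<close> to each component of \<open>G - v\<close> by an edge, so such
  a \<open>C\<close> forces domination of \<open>v\<close>; if there is none, then deleting all edges between \<open>v\<close> and \<open>S\<close>
  leaves a connected graph, any spanning tree of which leaves \<open>v\<close> undominated. On the other hand
  the sets \<open>N(v) \<inter> C\<close> are exactly the sets \<open>N\<^sub>B(v)\<close> for the blocks \<open>B\<close> at \<open>v\<close>: a block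
  minus \<open>v\<close> is connected, and two neighbours of \<open>v\<close> in the same component lie with \<open>v\<close> on a
  common cycle, which can be glued to the block.
\<close>

subsection \<open>Reachability\<close>

text \<open>Names the relation inside \<open>reach\<close>, so that facts about
  \<open>rtrancl\<close> apply to it directly.\<close>

definition adj :: "'a ugraph \<Rightarrow> ('a \<times> 'a) set" where
  "adj G = {(x, y). {x, y} \<in> edges G}"

lemma reach_iff: "(u, v) \<in> reach G \<longleftrightarrow> u \<in> verts G \<and> v \<in> verts G \<and> (u, v) \<in> (adj G)\<^sup>*"
  by (simp add: reach_def adj_def)

lemma adj_iff [simp]: "(x, y) \<in> adj G \<longleftrightarrow> {x, y} \<in> edges G"
  by (simp add: adj_def)

lemma adj_rtrancl_sym: "(x, y) \<in> (adj G)\<^sup>* \<Longrightarrow> (y, x) \<in> (adj G)\<^sup>*"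
proof -
  have "sym (adj G)"
    by (auto simp: sym_def insert_commute)
  then show "(x, y) \<in> (adj G)\<^sup>* \<Longrightarrow> (y, x) \<in> (adj G)\<^sup>*"
    by (meson sym_rtrancl symD)
qed

lemma adj_rtrancl_mono: "(x, y) \<in> (adj H)\<^sup>* \<Longrightarrow> edges H \<subseteq> edges G \<Longrightarrow> (x, y) \<in> (adj G)\<^sup>*"
  by (rule rtrancl_mono[THEN subsetD, rotated]) auto

lemma simple_graph_edgeD:
  assumes "simple_graph G" "{x, y} \<in> edges G"
  shows "x \<in> verts G" "y \<in> verts G" "x \<noteq> y"
  using assms by (auto simp: simple_graph_def)

lemma reach_refl: "x \<in> verts G \<Longrightarrow> (x, x) \<in> reach G"
  by (simp add: reach_iff)

lemma reach_sym: "(x, y) \<in> reach G \<Longrightarrow> (y, x) \<in> reach G"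
  by (auto simp: reach_iff intro: adj_rtrancl_sym)

lemma reach_trans: "(x, y) \<in> reach G \<Longrightarrow> (y, z) \<in> reach G \<Longrightarrow> (x, z) \<in> reach G"
  by (auto simp: reach_iff)

lemma reach_mono:
  "(x, y) \<in> reach H \<Longrightarrow> verts H \<subseteq> verts G \<Longrightarrow> edges H \<subseteq> edges G \<Longrightarrow> (x, y) \<in> reach G"
  unfolding reach_iff by (meson adj_rtrancl_mono subsetD)

lemma equiv_reach: "equiv (verts G) (reach G)"
  by (rule equivI)
    (auto simp: refl_on_def sym_def trans_def reach_iff intro: adj_rtrancl_sym rtrancl_trans)

section \<open>Connectedness, cut vertices and 2-connectedness in terms of reachability\<close>

text \<open>Connectedness that also admits the empty graph, which arises when the only vertex of a
  graph is deleted.\<close>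

definition all_reachable :: "'a ugraph \<Rightarrow> bool" where
  "all_reachable G \<longleftrightarrow> (\<forall>u\<in>verts G. \<forall>v\<in>verts G. (u, v) \<in> reach G)"

lemma connected_graph_iff: "connected_graph G \<longleftrightarrow> verts G \<noteq> {} \<and> all_reachable G"
  by (simp add: connected_graph_def all_reachable_def)

lemma all_reachable_hub:
  assumes "\<And>u. u \<in> verts G \<Longrightarrow> (u, c) \<in> reach G"
  shows "all_reachable G"
  unfolding all_reachable_def by (meson assms reach_sym reach_trans)

text \<open>Components are the classes of an equivalence relation, and there is at most one class
  exactly when any two vertices are equivalent. The empty graph has no class, hence the bound
  instead of an equality.\<close>

lemma all_reachable_iff_card_components:
  assumes "finite (verts G)"
  shows "all_reachable G \<longleftrightarrow> card (components G) \<le> 1"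
proof -
  have fin: "finite (components G)"
    unfolding components_def
    by (rule finite_quotient[OF assms]) (auto simp: reach_iff)
  have "card (components G) \<le> 1 \<longleftrightarrow> (\<forall>C\<in>components G. \<forall>D\<in>components G. C = D)"
    using fin card_le_Suc0_iff_eq by auto
  also have "\<dots> \<longleftrightarrow> (\<forall>u\<in>verts G. \<forall>v\<in>verts G. reach G `` {u} = reach G `` {v})"
    by (simp add: components_def quotient_def)
  also have "\<dots> \<longleftrightarrow> all_reachable G"
    unfolding all_reachable_def
    by (intro ball_cong refl) (simp add: eq_equiv_class_iff[OF equiv_reach])
  finally show ?thesis ..
qed

lemma verts_delete_vertex [simp]: "verts (delete_vertex G v) = verts G - {v}"
  and edges_delete_vertex [simp]: "edges (delete_vertex G v) = {e \<in> edges G. v \<notin> e}"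
  by (simp_all add: delete_vertex_def)

text \<open>A connected graph has exactly one component, so the count grows exactly when at least
  two remain after the deletion.\<close>

lemma cut_vertex_iff:
  assumes "finite (verts G)" "connected_graph G" "v \<in> verts G"
  shows "cut_vertex G v \<longleftrightarrow> \<not> all_reachable (delete_vertex G v)"
proof -
  have "card (components G) \<le> 1"
    using assms by (simp add: connected_graph_iff all_reachable_iff_card_components)
  moreover have "components G \<noteq> {}" "finite (components G)"
    using assms unfolding components_def
    by (auto simp: connected_graph_def reach_iff intro!: finite_quotient)
  ultimately have "card (components G) = 1"
    by (metis card_0_eq le_antisym less_one not_le)
  with assms show ?thesis
    by (auto simp: cut_vertex_def all_reachable_iff_card_components)
qed

text \<open>Deleting a non-vertex leaves a simple graph unchanged, so \<open>v\<close> may range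
  over everything. This spares case distinctions when a vertex is deleted from a union of two
  graphs.\<close>

lemma two_connected_iff:
  assumes "simple_graph G"
  shows "two_connected G \<longleftrightarrow>
    verts G \<noteq> {} \<and> all_reachable G \<and> (\<forall>v. all_reachable (delete_vertex G v))"
proof -
  have fin: "finite (verts G)"
    using assms by (simp add: simple_graph_def)
  have "delete_vertex G v = G" if "v \<notin> verts G" for v
    using assms that by (auto simp: delete_vertex_def simple_graph_def prod_eq_iff)
  then show ?thesis
    unfolding two_connected_def connected_graph_iff
    using cut_vertex_iff[OF fin] by (metis connected_graph_iff cut_vertex_def)
qed

section \<open>Paths as vertex lists\<close>

lemma path_reach:
  assumes "successively (\<lambda>x y. {x, y} \<in> edges G) p" "set p \<subseteq> verts G"
    and "x \<in> set p" "y \<in> set p"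
  shows "(x, y) \<in> reach G"
proof -
  have hd: "(hd p, z) \<in> reach G" if "z \<in> set p" for z
    using assms(1,2) that
  proof (induction p)
    case (Cons a p)
    show ?case
    proof (cases "z = a")
      case False
      then have "(hd p, z) \<in> reach G" "p \<noteq> []" "{a, hd p} \<in> edges G"
        using Cons by (auto simp: successively_Cons)
      moreover from this have "(a, hd p) \<in> reach G"
        using Cons.prems by (auto simp: reach_iff)
      ultimately show ?thesis
        by (auto intro: reach_trans)
    qed (use Cons.prems in \<open>auto intro: reach_refl\<close>)
  qed simp
  show ?thesis
    by (rule reach_trans[OF reach_sym[OF hd[OF assms(3)]] hd[OF assms(4)]])
qed

text \<open>A path is built backwards from \<open>w\<close>. If the vertex to be prepended already
  lies on it, the part before that vertex is dropped, which keeps the list distinct.\<close>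

lemma reach_distinct_path:
  assumes "(u, w) \<in> reach G" "simple_graph G"
  obtains p where "p \<noteq> []" "hd p = u" "last p = w" "distinct p" "set p \<subseteq> verts G"
    "successively (\<lambda>x y. {x, y} \<in> edges G) p"
proof -
  have "(u, w) \<in> (adj G)\<^sup>*" "w \<in> verts G"
    using assms by (auto simp: reach_iff)
  then have "\<exists>p. p \<noteq> [] \<and> hd p = u \<and> last p = w \<and> distinct p \<and> set p \<subseteq> verts G \<and>
    successively (\<lambda>x y. {x, y} \<in> edges G) p"
  proof (induction rule: converse_rtrancl_induct)
    case base
    then show ?case
      by (intro exI[of _ "[w]"]) auto
  next
    case (step x y)
    then obtain p where p: "p \<noteq> []" "hd p = y" "last p = w" "distinct p" "set p \<subseteq> verts G"
      "successively (\<lambda>x y. {x, y} \<in> edges G) p"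
      by blast
    show ?case
    proof (cases "x \<in> set p")
      case True
      then obtain as bs where "p = as @ x # bs"
        by (meson split_list)
      then show ?thesis
        using p by (intro exI[of _ "x # bs"]) (auto simp: successively_append_iff)
    next
      case False
      then show ?thesis
        using p step.hyps simple_graph_edgeD[OF assms(2), of x y]
        by (intro exI[of _ "x # p"]) (auto simp: successively_Cons)
    qed
  qed
  then show thesis
    using that by blast
qed

subsection \<open>Spanning trees\<close>

text \<open>The rest of the cycle is a detour between the ends of the deleted edge, so each use of
  that edge in a walk can be replaced.\<close>

lemma delete_cycle_edge_all_reachable:
  assumes "all_reachable (V, F)" "cycle (V, F) c"
  shows "all_reachable (V, F - {{last c, hd c}})"
proof -
  let ?H = "(V, F - {{last c, hd c}})"
  have c: "length c \<ge> 3" "distinct c" "set c \<subseteq> V" "successively (\<lambda>x y. {x, y} \<in> F) c"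
    using assms(2) by (auto simp: cycle_def)
  \<comment> \<open>The closing edge is not also an edge between consecutive list entries; this uses
    distinctness and length at least 3, since in a list of length 2 both coincide.\<close>
  have "{c ! i, c ! Suc i} \<noteq> {last c, hd c}" if "Suc i < length c" for i
  proof -
    have "c \<noteq> []"
      using c by auto
    then have "last c = c ! (length c - 1)" "hd c = c ! 0"
      by (simp_all add: last_conv_nth hd_conv_nth)
    then show ?thesis
      using that c \<open>c \<noteq> []\<close> by (auto simp: doubleton_eq_iff nth_eq_iff_index_eq)
  qed
  with c(4) have "successively (\<lambda>x y. {x, y} \<in> edges ?H) c"
    by (auto simp: successively_conv_nth)
  moreover have "last c \<in> set c" "hd c \<in> set c"
    using c(1) by (auto intro!: last_in_set hd_in_set)
  ultimately have bridge: "(last c, hd c) \<in> reach ?H"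
    using c(3) by (intro path_reach) auto
  have step: "(x, y) \<in> (adj ?H)\<^sup>*" if "(x, y) \<in> adj (V, F)" for x y
  proof (cases "{x, y} = {last c, hd c}")
    case True
    then show ?thesis
      using bridge reach_sym[OF bridge] by (auto simp: doubleton_eq_iff reach_iff)
  next
    case False
    then have "(x, y) \<in> adj ?H"
      using that by (simp only: adj_iff snd_conv) blast
    then show ?thesis ..
  qed
  then have "(adj (V, F))\<^sup>* \<subseteq> (adj ?H)\<^sup>*"
    by (metis rtrancl_subset_rtrancl subrelI)
  with assms(1) show ?thesis
    by (auto simp: all_reachable_def reach_iff)
qed

text \<open>Among the edge sets that keep all vertices connected, one of least cardinality has no
  cycle: a cycle edge could be removed.\<close>

lemma spanning_tree_exists:
  assumes "simple_graph G" "connected_graph G"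
  obtains T where "spanning_tree T G"
proof -
  define P where "P F \<longleftrightarrow> F \<subseteq> edges G \<and> all_reachable (verts G, F)" for F
  have fin: "finite (edges G)"
    by (rule finite_subset[of _ "Pow (verts G)"]) (use assms in \<open>auto simp: simple_graph_def\<close>)
  have "P (edges G)"
    using assms by (simp add: P_def connected_graph_iff)
  then obtain F where F: "P F" "\<And>F'. P F' \<Longrightarrow> card F \<le> card F'"
    using ex_has_least_nat[of P "edges G" card] by blast
  have "\<not> cycle (verts G, F) c" for c
  proof
    assume c: "cycle (verts G, F) c"
    have "P (F - {{last c, hd c}})"
      using F(1) delete_cycle_edge_all_reachable[OF _ c] by (auto simp: P_def)
    then have "card F \<le> card (F - {{last c, hd c}})"
      by (rule F(2))
    moreover have "{last c, hd c} \<in> F"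
      using c by (simp add: cycle_def)
    moreover have "finite F"
      using F(1) fin finite_subset by (auto simp: P_def)
    ultimately show False
      by (meson card_Diff1_less not_le)
  qed
  then have "spanning_tree (verts G, F) G"
    using F(1) assms
    by (auto simp: spanning_tree_def subgraph_def tree_def P_def simple_graph_def connected_graph_iff)
  then show thesis
    by (rule that)
qed

section \<open>Trees and the components left after deleting a vertex\<close>

text \<open>A walk in \<open>T\<close> from \<open>c\<close> stays in one component of
  \<open>G - v\<close> until it first meets \<open>v\<close>, and the vertex just before that is a
  neighbour of \<open>v\<close> in \<open>T\<close>.\<close>

lemma reach_delete_vertex_or_neighbour:
  assumes "simple_graph G" "subgraph T G" "c \<in> verts G - {v}" "(c, x) \<in> (adj T)\<^sup>*"
  shows "(c, x) \<in> reach (delete_vertex G v) \<or>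
    (\<exists>n\<in>neighbours T v. (c, n) \<in> reach (delete_vertex G v))"
  using assms(4)
proof (induction rule: rtrancl_induct)
  case base
  then show ?case
    using assms(3) by (auto intro!: reach_refl)
next
  case (step y z)
  have T: "simple_graph T" "edges T \<subseteq> edges G" "verts T \<subseteq> verts G"
    using assms(2) by (auto simp: subgraph_def)
  have yz: "y \<in> verts T" "z \<in> verts T"
    using step.hyps(2) simple_graph_edgeD[OF T(1)] by auto
  show ?case
  proof (cases "(c, y) \<in> reach (delete_vertex G v)")
    case True
    show ?thesis
    proof (cases "z = v")
      case True
      then have "y \<in> neighbours T v"
        using step.hyps yz by (auto simp: neighbours_def)
      then show ?thesis
        using \<open>(c, y) \<in> reach (delete_vertex G v)\<close> by blast
    next
      case False
      have "y \<noteq> v"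
        using True by (simp add: reach_iff)
      then have "(y, z) \<in> reach (delete_vertex G v)"
        using False yz T step.hyps(2) by (auto simp: reach_iff intro!: r_into_rtrancl)
      then show ?thesis
        using reach_trans[OF True] by simp
    qed
  qed (use step.IH in blast)
qed

text \<open>Apply the preceding lemma to a walk from \<open>c\<close> to \<open>v\<close>; its first
  alternative fails because \<open>v\<close> is not in \<open>G - v\<close>. \<open>T\<close> will
  be a spanning tree, a block or \<open>G\<close> itself.\<close>

lemma neighbour_in_component:
  assumes "simple_graph G" "subgraph T G" "all_reachable T" "v \<in> verts T" "c \<in> verts T - {v}"
  obtains n where "n \<in> neighbours T v" "(c, n) \<in> reach (delete_vertex G v)"
proof -
  have "(c, v) \<in> (adj T)\<^sup>*"
    using assms(3-5) by (auto simp: all_reachable_def reach_iff)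
  moreover have "c \<in> verts G - {v}"
    using assms by (auto simp: subgraph_def)
  ultimately show thesis
    using reach_delete_vertex_or_neighbour[OF assms(1,2)] that by (fastforce simp: reach_iff)
qed

lemma subgraph_refl: "simple_graph G \<Longrightarrow> subgraph G G"
  by (simp add: subgraph_def)

lemma subgraph_trans: "subgraph A B \<Longrightarrow> subgraph B C \<Longrightarrow> subgraph A C"
  by (auto simp: subgraph_def)

text \<open>The vertex \<open>c\<close> on the right represents a component of \<open>G - v\<close>.
  Every spanning tree has an edge from \<open>v\<close> into that component; its other end then lies
  in \<open>S\<close>.\<close>

lemma dominated_in_all_spanning_trees_iff:
  assumes "simple_graph G" "connected_graph G" "v \<in> verts G" "v \<notin> S"
  shows "(\<forall>T. spanning_tree T G \<longrightarrow> neighbours T v \<inter> S \<noteq> {}) \<longleftrightarrow>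
    (\<exists>c\<in>verts G - {v}. \<forall>n\<in>neighbours G v. (c, n) \<in> reach (delete_vertex G v) \<longrightarrow> n \<in> S)"
    (is "?L \<longleftrightarrow> ?R")
proof
  assume ?R
  then obtain c where c: "c \<in> verts G - {v}"
    "\<And>n. n \<in> neighbours G v \<Longrightarrow> (c, n) \<in> reach (delete_vertex G v) \<Longrightarrow> n \<in> S"
    by blast
  show ?L
  proof (intro allI impI)
    fix T assume "spanning_tree T G"
    then have T: "subgraph T G" "verts T = verts G" "all_reachable T"
      by (auto simp: spanning_tree_def tree_def connected_graph_iff)
    obtain n where n: "n \<in> neighbours T v" "(c, n) \<in> reach (delete_vertex G v)"
      using neighbour_in_component[OF assms(1) T(1,3)] T(2) assms(3) c(1) by metis
    moreover have "n \<in> neighbours G v"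
      using n(1) T(1) by (auto simp: neighbours_def subgraph_def)
    ultimately show "neighbours T v \<inter> S \<noteq> {}"
      using c(2) by blast
  qed
next
  assume L: ?L
  show ?R
  proof (rule ccontr)
    assume "\<not> ?R"
    then have ex: "\<exists>n\<in>neighbours G v. (c, n) \<in> reach (delete_vertex G v) \<and> n \<notin> S"
      if "c \<in> verts G - {v}" for c
      using that by blast
    \<comment> \<open>All edges between \<open>v\<close> and \<open>S\<close> are removed. Each
      component of \<open>G - v\<close> has a neighbour of \<open>v\<close> outside
      \<open>S\<close>, so \<open>H\<close> is connected, and a spanning tree of \<open>H\<close>
      leaves \<open>v\<close> undominated.\<close>
    define H where "H = (verts G, {e \<in> edges G. \<not> (v \<in> e \<and> e \<inter> S \<noteq> {})})"
    have H: "subgraph H G" "verts H = verts G" "simple_graph H"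
      using assms(1) by (auto simp: H_def subgraph_def simple_graph_def)
    have "(c, v) \<in> reach H" if "c \<in> verts H" for c
    proof (cases "c = v")
      case False
      with that have "c \<in> verts G - {v}"
        using H(2) by simp
      from ex[OF this] obtain n
        where n: "n \<in> neighbours G v" "(c, n) \<in> reach (delete_vertex G v)" "n \<notin> S"
        by blast
      have "(c, n) \<in> reach H"
        by (rule reach_mono[OF n(2)]) (auto simp: H_def)
      \<comment> \<open>The edge between \<open>n\<close> and \<open>v\<close> survives in
        \<open>H\<close> because neither end lies in \<open>S\<close>.\<close>
      moreover have "(n, v) \<in> reach H"
        using n assms by (auto simp: H_def reach_iff neighbours_def)
      ultimately show ?thesis
        by (rule reach_trans)
    qed (use that in \<open>auto intro: reach_refl\<close>)
    then have "connected_graph H"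
      using assms(3) H(2) by (auto simp: connected_graph_iff intro!: all_reachable_hub)
    then obtain T where T: "spanning_tree T H"
      using spanning_tree_exists H(3) by blast
    then have "spanning_tree T G"
      using H subgraph_trans unfolding spanning_tree_def by metis
    then obtain n where "n \<in> neighbours T v" "n \<in> S"
      using L by blast
    then show False
      using T by (auto simp: spanning_tree_def subgraph_def neighbours_def H_def)
  qed
qed

subsection \<open>Blocks\<close>

text \<open>The seed from which a block through a given edge is grown.\<close>

lemma two_connected_edge:
  assumes "u \<noteq> v"
  shows "simple_graph ({u, v}, {{u, v}})" "two_connected ({u, v}, {{u, v}})"
proof -
  let ?K = "({u, v}, {{u, v}})"
  show simple: "simple_graph ?K"
    using assms by (auto simp: simple_graph_def)
  have "all_reachable ?K"
    by (rule all_reachable_hub[of _ u]) (auto simp: reach_iff insert_commute)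
  moreover have "all_reachable (delete_vertex ?K x)" for x
    using calculation by (cases "x = u"; cases "x = v")
      (auto simp: all_reachable_def reach_iff delete_vertex_def)
  ultimately show "two_connected ?K"
    by (simp add: two_connected_iff[OF simple])
qed

text \<open>A cycle minus a vertex is a path. Taking the induced subgraph, chords included, makes
  what remains after the deletion again induced on the vertices of a path.\<close>

lemma two_connected_cycle:
  assumes "simple_graph G" "cycle G c"
  shows "two_connected (set c, {e \<in> edges G. e \<subseteq> set c})"
proof -
  let ?C = "(set c, {e \<in> edges G. e \<subseteq> set c})"
  have c: "length c \<ge> 3" "distinct c" "{last c, hd c} \<in> edges G"
    "successively (\<lambda>x y. {x, y} \<in> edges G) c"
    using assms(2) by (auto simp: cycle_def)
  have simple: "simple_graph ?C"
    using assms(1) by (auto simp: simple_graph_def)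
  have path: "all_reachable H"
    if "successively (\<lambda>x y. {x, y} \<in> edges G) p" "verts H = set p"
      "edges H = {e \<in> edges G. e \<subseteq> set p}" for H p
    using that path_reach[of H p]
    by (auto simp: all_reachable_def elim!: successively_mono)
  have whole: "all_reachable ?C"
    by (rule path[OF c(4)]) auto
  moreover have "all_reachable (delete_vertex ?C x)" for x
  proof (cases "x \<in> set c")
    case True
    then obtain xs ys where xs: "c = xs @ x # ys"
      by (meson split_list)
    \<comment> \<open>Cutting the cycle at \<open>x\<close> and rotating puts \<open>ys\<close>
      first; the closing edge of \<open>c\<close> joins \<open>ys\<close> to \<open>xs\<close> when
      both are nonempty.\<close>
    have "successively (\<lambda>x y. {x, y} \<in> edges G) (ys @ xs)"
      using c(3,4) unfolding xs
      by (cases "xs = []"; cases "ys = []") (auto simp: successively_append_iff successively_Cons)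
    then show ?thesis
      by (rule path) (use c(2) in \<open>auto simp: xs\<close>)
  next
    case False
    then have "delete_vertex ?C x = ?C"
      by (auto simp: delete_vertex_def)
    with whole show ?thesis
      by simp
  qed
  moreover have "set c \<noteq> {}"
    using c(1) by auto
  ultimately show ?thesis
    by (simp add: two_connected_iff[OF simple])
qed

lemma all_reachable_Un:
  assumes "all_reachable A" "all_reachable B" "c \<in> verts A" "c \<in> verts B"
    and "verts H = verts A \<union> verts B" "edges A \<union> edges B \<subseteq> edges H"
  shows "all_reachable H"
proof (rule all_reachable_hub)
  fix u assume "u \<in> verts H"
  then have "(u, c) \<in> reach A \<or> (u, c) \<in> reach B"
    using assms by (auto simp: all_reachable_def)
  then show "(u, c) \<in> reach H"
    using assms(5,6) reach_mono[of u c A H] reach_mono[of u c B H] by blast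
qed

text \<open>Of the two common vertices at least one survives the deletion of any vertex, and it
  links the two connected remainders.\<close>

lemma two_connected_Un:
  assumes "simple_graph A" "simple_graph B" "two_connected A" "two_connected B"
    and "{a, b} \<subseteq> verts A \<inter> verts B" "a \<noteq> b"
  shows "two_connected (verts A \<union> verts B, edges A \<union> edges B)"
proof -
  let ?H = "(verts A \<union> verts B, edges A \<union> edges B)"
  have simple: "simple_graph ?H"
    using assms(1,2) by (auto simp: simple_graph_def)
  have A: "all_reachable A" "\<And>v. all_reachable (delete_vertex A v)"
    and B: "all_reachable B" "\<And>v. all_reachable (delete_vertex B v)"
    using assms by (auto simp: two_connected_iff)
  have "all_reachable ?H"
    by (rule all_reachable_Un[OF A(1) B(1), of a]) (use assms in auto)
  moreover have "all_reachable (delete_vertex ?H x)" for x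
    by (rule all_reachable_Un[OF A(2)[of x] B(2)[of x], of "if x = a then b else a"])
      (use assms in auto)
  ultimately show ?thesis
    using assms(5) by (auto simp: two_connected_iff[OF simple])
qed

section \<open>Existence of blocks and gluing to a block\<close>

text \<open>By finiteness there is a largest 2-connected subgraph of \<open>G\<close> containing
  \<open>H\<close>.\<close>

lemma block_extends:
  assumes "simple_graph G" "subgraph H G" "two_connected H"
  obtains B where "block B G" "subgraph H B"
proof -
  define P where "P B \<longleftrightarrow> subgraph B G \<and> two_connected B \<and> subgraph H B" for B
  \<comment> \<open>Blocks are maximal in both vertices and edges, so size counts both; equal sums
    then force both inclusions to be equalities.\<close>
  define m where "m B = card (verts B) + card (edges B)" for B :: "'a ugraph"
  have finE: "finite (edges B)" if "simple_graph B" for B :: "'a ugraph"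
    by (rule finite_subset[of _ "Pow (verts B)"]) (use that in \<open>auto simp: simple_graph_def\<close>)
  have finV: "finite (verts B)" if "simple_graph B" for B :: "'a ugraph"
    using that by (simp add: simple_graph_def)
  have "m B \<le> m G" if "P B" for B
    using that finE[OF assms(1)] finV[OF assms(1)]
    by (auto simp: m_def P_def subgraph_def intro!: add_mono card_mono)
  then have bound: "\<forall>B. P B \<longrightarrow> m B < Suc (m G)"
    by (simp add: less_Suc_eq_le)
  have "P H"
    using assms by (auto simp: P_def subgraph_def)
  then obtain B where B: "P B" "\<And>B'. P B' \<Longrightarrow> m B' \<le> m B"
    using ex_has_greatest_nat[OF _ bound] by blast
  have "B' = B" if B': "subgraph B' G" "two_connected B'" "subgraph B B'" for B'
  proof -
    have "P B'"
      using B(1) B' subgraph_trans unfolding P_def by blast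
    then have le: "m B' \<le> m B"
      by (rule B(2))
    have sub: "verts B \<subseteq> verts B'" "edges B \<subseteq> edges B'" and fin: "finite (verts B')" "finite (edges B')"
      using B' finE finV by (auto simp: subgraph_def)
    have "card (verts B) \<le> card (verts B')" "card (edges B) \<le> card (edges B')"
      using sub fin by (auto intro: card_mono)
    with le have "card (verts B) = card (verts B')" "card (edges B) = card (edges B')"
      by (auto simp: m_def)
    then show ?thesis
      using sub fin card_subset_eq by (metis prod_eqI)
  qed
  then have "block B G"
    using B(1) by (auto simp: block_def P_def)
  then show thesis
    using B(1) that by (auto simp: P_def)
qed

text \<open>The union of \<open>B\<close> and \<open>C\<close> is 2-connected, so maximality of
  \<open>B\<close> makes it equal to \<open>B\<close>.\<close>

lemma block_absorbs:
  assumes "simple_graph G" "block B G" "subgraph C G" "two_connected C"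
    and "{a, b} \<subseteq> verts B \<inter> verts C" "a \<noteq> b"
  shows "edges C \<subseteq> edges B"
proof -
  let ?U = "(verts B \<union> verts C, edges B \<union> edges C)"
  have B: "subgraph B G" "two_connected B"
    using assms(2) by (auto simp: block_def)
  have simple: "simple_graph B" "simple_graph C"
    using B assms(3) by (auto simp: subgraph_def)
  have "two_connected ?U"
    by (rule two_connected_Un) (use simple B assms in auto)
  moreover have "subgraph ?U G" "subgraph B ?U"
    using B assms(3) simple by (auto simp: subgraph_def simple_graph_def)
  ultimately have "?U = B"
    using assms(2) unfolding block_def by blast
  then show ?thesis
    by (metis Un_upper2 snd_conv)
qed

text \<open>A path from \<open>u\<close> to \<open>w\<close> avoiding \<open>v\<close> closes up
  through \<open>v\<close> to a cycle. It shares \<open>u\<close> and \<open>v\<close> with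
  \<open>B\<close>, so \<open>B\<close> absorbs it together with the edge between \<open>w\<close>
  and \<open>v\<close>.\<close>

lemma block_neighbours_closed:
  assumes "simple_graph G" "block B G" "v \<in> verts B" "u \<in> neighbours B v"
    and "w \<in> neighbours G v" "(u, w) \<in> reach (delete_vertex G v)"
  shows "w \<in> neighbours B v"
proof (cases "w = u")
  case False
  have B: "subgraph B G" "simple_graph B"
    using assms(2) by (auto simp: block_def subgraph_def)
  have simple: "simple_graph (delete_vertex G v)"
    using assms(1) by (auto simp: simple_graph_def)
  obtain p where p: "p \<noteq> []" "hd p = u" "last p = w" "distinct p"
    "set p \<subseteq> verts (delete_vertex G v)"
    "successively (\<lambda>x y. {x, y} \<in> edges (delete_vertex G v)) p"
    using reach_distinct_path[OF assms(6) simple] .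
  let ?c = "v # p"
  let ?C = "(set ?c, {e \<in> edges G. e \<subseteq> set ?c})"
  have edges: "{u, v} \<in> edges B" "{u, v} \<in> edges G" "{w, v} \<in> edges G"
    and verts: "u \<in> verts B" "v \<in> verts G"
    using assms B by (auto simp: neighbours_def subgraph_def)
  have "u \<noteq> v"
    using simple_graph_edgeD(3)[OF B(2) edges(1)] .
  have mem: "u \<in> set p" "w \<in> set p"
    using p by auto
  \<comment> \<open>Since \<open>u\<close> and \<open>w\<close> differ, adding \<open>v\<close>
    gives the three vertices that a cycle needs.\<close>
  have "length p \<ge> 2"
    using p False by (cases p; cases "tl p") auto
  moreover have "successively (\<lambda>x y. {x, y} \<in> edges G) p"
    using p(6) by (rule successively_mono) auto
  ultimately have "cycle G ?c"
    using p edges verts by (auto simp: cycle_def successively_Cons insert_commute)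
  then have "two_connected ?C"
    by (rule two_connected_cycle[OF assms(1)])
  moreover have "subgraph ?C G"
    using assms(1) p(5) verts by (auto simp: subgraph_def simple_graph_def)
  moreover have "{u, v} \<subseteq> verts B \<inter> verts ?C"
    using assms(3) verts mem by auto
  ultimately have "edges ?C \<subseteq> edges B"
    using block_absorbs[OF assms(1,2)] \<open>u \<noteq> v\<close> by metis
  then have "{w, v} \<in> edges B"
    using edges mem by auto
  then show ?thesis
    using simple_graph_edgeD[OF B(2)] by (auto simp: neighbours_def)
qed (use assms in simp)

section \<open>Neighbours in blocks versus neighbours in components\<close>

text \<open>A neighbour of \<open>v\<close> in a block picks out a component of
  \<open>G - v\<close>; conversely, a neighbour in a component yields an edge at \<open>v\<close>,
  which extends to a block. Corresponding blocks and components contain the same neighbours of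
  \<open>v\<close>.\<close>

lemma block_neighbours_subset_iff:
  assumes "simple_graph G" "connected_graph G" "v \<in> verts G" "verts G \<noteq> {v}"
  shows "(\<exists>B. block B G \<and> v \<in> verts B \<and> neighbours B v \<subseteq> S) \<longleftrightarrow>
    (\<exists>c\<in>verts G - {v}. \<forall>n\<in>neighbours G v. (c, n) \<in> reach (delete_vertex G v) \<longrightarrow> n \<in> S)"
    (is "?L \<longleftrightarrow> ?R")
proof -
  have G: "subgraph G G" "all_reachable G"
    using assms by (auto simp: subgraph_refl connected_graph_iff)
  have edge: "subgraph ({u, v}, {{u, v}}) G" "two_connected ({u, v}, {{u, v}})"
    if "u \<in> neighbours G v" for u
  proof -
    have "{u, v} \<in> edges G"
      using that by (simp add: neighbours_def)
    from simple_graph_edgeD[OF assms(1) this] this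
    show "subgraph ({u, v}, {{u, v}}) G" "two_connected ({u, v}, {{u, v}})"
      using two_connected_edge[of u v] by (auto simp: subgraph_def)
  qed
  show ?thesis
  proof
    assume ?L
    then obtain B where B: "block B G" "v \<in> verts B" "neighbours B v \<subseteq> S"
      by blast
    have B': "subgraph B G" "simple_graph B" "two_connected B" "all_reachable B"
      using B(1) by (auto simp: block_def subgraph_def two_connected_iff)
    \<comment> \<open>A block consisting of \<open>v\<close> alone would not be maximal, as
      \<open>v\<close> has a neighbour in \<open>G\<close> and the edge to it is
      2-connected.\<close>
    have "verts B \<noteq> {v}"
    proof
      assume vB: "verts B = {v}"
      have noE: "edges B = {}"
      proof (rule equals0I)
        fix e assume "e \<in> edges B"
        then have "e \<subseteq> {v}" "card e = 2"
          using B'(2) vB by (auto simp: simple_graph_def)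
        then show False
          using card_mono[of "{v}" e] by simp
      qed
      obtain c where "c \<in> verts G - {v}"
        using assms(3,4) by blast
      from neighbour_in_component[OF assms(1) G assms(3) this]
      obtain u where u: "u \<in> neighbours G v" .
      have "subgraph B ({u, v}, {{u, v}})"
        using B'(2) vB noE by (auto simp: subgraph_def)
      then have "({u, v}, {{u, v}}) = B"
        using edge[OF u] B(1) unfolding block_def by blast
      then show False
        using noE by auto
    qed
    then obtain b where "b \<in> verts B - {v}"
      using B(2) by blast
    from neighbour_in_component[OF assms(1) B'(1,4) B(2) this]
    obtain u where u: "u \<in> neighbours B v" .
    have "{u, v} \<in> edges B"
      using u by (simp add: neighbours_def)
    then have "u \<in> verts G - {v}"
      using simple_graph_edgeD[OF B'(2)] B'(1) by (auto simp: subgraph_def)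
    moreover have "n \<in> S" if "n \<in> neighbours G v" "(u, n) \<in> reach (delete_vertex G v)" for n
      using block_neighbours_closed[OF assms(1) B(1,2) u that] B(3) by blast
    ultimately show ?R
      by blast
  next
    assume ?R
    then obtain c where c: "c \<in> verts G - {v}"
      "\<And>n. n \<in> neighbours G v \<Longrightarrow> (c, n) \<in> reach (delete_vertex G v) \<Longrightarrow> n \<in> S"
      by blast
    obtain u where u: "u \<in> neighbours G v" "(c, u) \<in> reach (delete_vertex G v)"
      using neighbour_in_component[OF assms(1) G assms(3) c(1)] .
    obtain B where B: "block B G" "subgraph ({u, v}, {{u, v}}) B"
      using block_extends[OF assms(1) edge[OF u(1)]] .
    have B': "subgraph B G" "simple_graph B" "all_reachable (delete_vertex B v)"
      using B(1) by (auto simp: block_def subgraph_def two_connected_iff)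
    have uv: "u \<in> verts B" "v \<in> verts B" "u \<noteq> v"
      using B(2) simple_graph_edgeD[OF B'(2), of u v] by (auto simp: subgraph_def)
    \<comment> \<open>\<open>B - v\<close> is connected, so every neighbour of \<open>v\<close> in
      \<open>B\<close> lies in the component of \<open>u\<close>, which is that of
      \<open>c\<close>.\<close>
    have "n \<in> S" if n: "n \<in> neighbours B v" for n
    proof -
      have "n \<in> verts B" "{n, v} \<in> edges B"
        using n by (auto simp: neighbours_def)
      moreover from this have "n \<noteq> v"
        using simple_graph_edgeD[OF B'(2)] by blast
      ultimately have "(u, n) \<in> reach (delete_vertex B v)"
        using B'(3) uv by (auto simp: all_reachable_def)
      then have "(u, n) \<in> reach (delete_vertex G v)"
        by (rule reach_mono) (use B'(1) in \<open>auto simp: subgraph_def\<close>)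
      then have "(c, n) \<in> reach (delete_vertex G v)"
        by (rule reach_trans[OF u(2)])
      moreover have "n \<in> neighbours G v"
        using n B'(1) by (auto simp: neighbours_def subgraph_def)
      ultimately show ?thesis
        using c(2) by blast
    qed
    then show ?L
      using B(1) uv(2) by blast
  qed
qed

text \<open>Here \<open>G - v\<close> is connected and nonempty, so its only component contains all
  neighbours of \<open>v\<close>.\<close>

lemma noncut_neighbours_subset_iff:
  assumes "simple_graph G" "connected_graph G" "v \<in> verts G" "verts G \<noteq> {v}"
    and "\<not> cut_vertex G v"
  shows "neighbours G v \<subseteq> S \<longleftrightarrow>
    (\<exists>c\<in>verts G - {v}. \<forall>n\<in>neighbours G v. (c, n) \<in> reach (delete_vertex G v) \<longrightarrow> n \<in> S)"
proof -
  have "all_reachable (delete_vertex G v)"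
    using assms cut_vertex_iff[of G v] by (simp add: simple_graph_def)
  moreover have "n \<in> verts G - {v}" if "n \<in> neighbours G v" for n
    using that simple_graph_edgeD[OF assms(1), of n v] by (auto simp: neighbours_def)
  ultimately have "(c, n) \<in> reach (delete_vertex G v)"
    if "c \<in> verts G - {v}" "n \<in> neighbours G v" for c n
    using that by (auto simp: all_reachable_def)
  then show ?thesis
    using assms(3,4) by blast
qed

text \<open>The assumption \<open>not_trivial\<close> excludes a genuine exception: for a single
  vertex and empty \<open>S\<close>, the vertex is not a cut vertex and has no neighbours, so the
  right side holds, yet \<open>S\<close> does not dominate the only spanning tree.\<close>

theorem theorem2:
  fixes V :: "'a set" and E :: "'a set set" and G :: "'a ugraph" and S :: "'a set"
  defines "G \<equiv> (V, E)"
  assumes "simple_graph G" and "connected_graph G" and "S \<subseteq> V"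
    and not_trivial: "\<not> (card V = 1 \<and> S = {})"
  shows "SD_set G S \<longleftrightarrow>
    (\<forall>v\<in>V. v \<in> S
      \<or> (\<not> cut_vertex G v \<and> neighbours G v \<subseteq> S)
      \<or> (cut_vertex G v \<and> (\<exists>B. block B G \<and> v \<in> verts B \<and> neighbours B v \<subseteq> S)))"
proof -
  have V: "verts G = V"
    by (simp add: G_def)
  have "SD_set G S \<longleftrightarrow>
      (\<forall>v\<in>V - S. \<forall>T. spanning_tree T G \<longrightarrow> neighbours T v \<inter> S \<noteq> {})"
    using assms(4) by (auto simp: SD_set_def dominating_def spanning_tree_def V)
  also have "\<dots> \<longleftrightarrow> (\<forall>v\<in>V - S. (\<not> cut_vertex G v \<and> neighbours G v \<subseteq> S)
      \<or> (cut_vertex G v \<and> (\<exists>B. block B G \<and> v \<in> verts B \<and> neighbours B v \<subseteq> S)))"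
  proof (rule ball_cong[OF refl])
    fix v assume v: "v \<in> V - S"
    \<comment> \<open>If \<open>v\<close> were the only vertex, \<open>S\<close> would be empty,
      which is the excluded case.\<close>
    then have "verts G \<noteq> {v}"
      using not_trivial assms(4) V by auto
    then show "(\<forall>T. spanning_tree T G \<longrightarrow> neighbours T v \<inter> S \<noteq> {}) \<longleftrightarrow>
      (\<not> cut_vertex G v \<and> neighbours G v \<subseteq> S)
      \<or> (cut_vertex G v \<and> (\<exists>B. block B G \<and> v \<in> verts B \<and> neighbours B v \<subseteq> S))"
      using v V dominated_in_all_spanning_trees_iff[OF assms(2,3), of v S]
        block_neighbours_subset_iff[OF assms(2,3), of v S]
        noncut_neighbours_subset_iff[OF assms(2,3), of v S]
      by (cases "cut_vertex G v") simp_all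
  qed
  finally show ?thesis
    by blast
qed

end
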